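(* Let $S$ be a monoid that is not left reversible. A right $S$-act $Q$ is injective if and only if it is injective relative to all inclusions into cyclic right $S$-acts.
   Context: A right $S$-act over a monoid $S$ is a nonempty set $A$ with a map $A\times S\to A$, $(a,s)\mapsto as$, such that $a(st)=(as)t$ and $a1=a$ for all $a\in A$, $s,t\in S$. Homomorphisms are maps commuting with the action; a subact is a nonempty subset closed under the action; an act $C$ is cyclic if $C=cS$ for some $c\in C$. A right $S$-act $Q$ is injective if for every right $S$-act $B$, every subact $A\subseteq B$ and every homomorphism $f:A\to Q$ there is a homomorphism $\bar f:B\to Q$ extending $f$; $Q$ is injective relative to all inclusions into cyclic right $S$-acts if this extension property holds whenever $B$ is cyclic. A monoid $S$ is left reversible if any two (nonempty) right ideals of $S$ have nonempty intersection. *)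

theory Defs
  imports "HOL-Algebra.Group"
begin

locale right_act = monoid S
  for S :: "('s, 'm) monoid_scheme" (structure) +
  fixes A :: "'a set" and act :: "'a \<Rightarrow> 's \<Rightarrow> 'a"
  assumes nonempty: "A \<noteq> {}"
    and act_closed: "\<lbrakk>a \<in> A; s \<in> carrier S\<rbrakk> \<Longrightarrow> act a s \<in> A"
    and act_mult: "\<lbrakk>a \<in> A; s \<in> carrier S; t \<in> carrier S\<rbrakk> \<Longrightarrow> act a (s \<otimes> t) = act (act a s) t"
    and act_one: "a \<in> A \<Longrightarrow> act a \<one> = a"

definition subact ::
  "('s, 'm) monoid_scheme \<Rightarrow> 'a set \<Rightarrow> 'a set \<Rightarrow> ('a \<Rightarrow> 's \<Rightarrow> 'a) \<Rightarrow> bool" where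
  "subact S A B act \<longleftrightarrow> A \<noteq> {} \<and> A \<subseteq> B \<and> (\<forall>a\<in>A. \<forall>s\<in>carrier S. act a s \<in> A)"

definition act_hom ::
  "('s, 'm) monoid_scheme \<Rightarrow> 'a set \<Rightarrow> ('a \<Rightarrow> 's \<Rightarrow> 'a) \<Rightarrow> 'b set \<Rightarrow> ('b \<Rightarrow> 's \<Rightarrow> 'b) \<Rightarrow> ('a \<Rightarrow> 'b) set" where
  "act_hom S A actA B actB =
    {f \<in> A \<rightarrow> B. \<forall>a\<in>A. \<forall>s\<in>carrier S. f (actA a s) = actB (f a) s}"

definition cyclic_act ::
  "('s, 'm) monoid_scheme \<Rightarrow> 'a set \<Rightarrow> ('a \<Rightarrow> 's \<Rightarrow> 'a) \<Rightarrow> bool" where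
  "cyclic_act S C act \<longleftrightarrow> right_act S C act \<and> (\<exists>c\<in>C. C = act c ` carrier S)"

definition injective_rel_inclusion ::
  "('s, 'm) monoid_scheme \<Rightarrow> 'q set \<Rightarrow> ('q \<Rightarrow> 's \<Rightarrow> 'q) \<Rightarrow> 'b set \<Rightarrow> 'b set \<Rightarrow> ('b \<Rightarrow> 's \<Rightarrow> 'b) \<Rightarrow> bool" where
  "injective_rel_inclusion S Q actQ A B actB \<longleftrightarrow>
    (\<forall>f\<in>act_hom S A actB Q actQ. \<exists>g\<in>act_hom S B actB Q actQ. \<forall>a\<in>A. g a = f a)"

text \<open>HOL cannot quantify over types inside a formula, so the next two notions carry the type
  of the elements of the test acts as an explicit argument.\<close>

definition injective_act ::
  "'b itself \<Rightarrow> ('s, 'm) monoid_scheme \<Rightarrow> 'q set \<Rightarrow> ('q \<Rightarrow> 's \<Rightarrow> 'q) \<Rightarrow> bool" where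
  "injective_act (_ :: 'b itself) S Q actQ \<longleftrightarrow>
    (\<forall>(B :: 'b set) actB A. right_act S B actB \<longrightarrow> subact S A B actB \<longrightarrow>
      injective_rel_inclusion S Q actQ A B actB)"

definition cyclic_injective_act ::
  "'b itself \<Rightarrow> ('s, 'm) monoid_scheme \<Rightarrow> 'q set \<Rightarrow> ('q \<Rightarrow> 's \<Rightarrow> 'q) \<Rightarrow> bool" where
  "cyclic_injective_act (_ :: 'b itself) S Q actQ \<longleftrightarrow>
    (\<forall>(B :: 'b set) actB A. cyclic_act S B actB \<longrightarrow> subact S A B actB \<longrightarrow>
      injective_rel_inclusion S Q actQ A B actB)"

definition right_ideal :: "('s, 'm) monoid_scheme \<Rightarrow> 's set \<Rightarrow> bool" where
  "right_ideal S I \<longleftrightarrow>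
    I \<noteq> {} \<and> I \<subseteq> carrier S \<and> (\<forall>x\<in>I. \<forall>s\<in>carrier S. x \<otimes>\<^bsub>S\<^esub> s \<in> I)"

definition left_reversible :: "('s, 'm) monoid_scheme \<Rightarrow> bool" where
  "left_reversible S \<longleftrightarrow> (\<forall>I J. right_ideal S I \<longrightarrow> right_ideal S J \<longrightarrow> I \<inter> J \<noteq> {})"

text \<open>Test acts for a monoid over \<open>'s\<close> should be taken over a type \<open>'s + 'b\<close> with \<open>'b\<close>
  arbitrary: every act over \<open>'b\<close> is isomorphic to one over \<open>'s + 'b\<close>, and the summand \<open>'s\<close>
  guarantees room for a copy of every cyclic act, these being quotients of the monoid.  Over a
  type that is too small (such as \<^typ>\<open>unit\<close>) both injectivity notions can hold trivially.\<close>

end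

theory Submission imports Defs begin

text \<open>
  By a Baer-type argument with Zorn's lemma, an act with a zero (an element fixed by the whole
  monoid) is injective as soon as it is injective relative to inclusions into cyclic acts: a
  maximal partial extension whose domain misses \<open>b\<close> can be enlarged to \<open>bS\<close>, the zero serving
  as value when \<open>bS\<close> does not meet the domain. If \<open>I\<close> and \<open>J\<close> are disjoint right ideals, then
  \<open>J\<close> is a subact of the Rees quotient \<open>S/I\<close>, which is cyclic and has a zero; extending
  \<open>j \<mapsto> qj\<close> from \<open>J\<close> to \<open>S/I\<close> sends this zero to a zero of \<open>Q\<close>.
\<close>

section \<open>Transport of acts along injective maps\<close>

lemma right_act_image:
  assumes "right_act S B act" "inj_on h B"
  shows "right_act S (h ` B) (\<lambda>y s. h (act (inv_into B h y) s))"
proof -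
  interpret right_act S B act by fact
  show ?thesis
    by unfold_locales (use assms(2) nonempty act_closed act_mult act_one in auto)
qed

lemma subact_image:
  assumes "subact S A B act" "inj_on h B"
  shows "subact S (h ` A) (h ` B) (\<lambda>y s. h (act (inv_into B h y) s))"
proof -
  have "inv_into B h (h a) = a" if "a \<in> A" for a
    using assms that by (auto simp: subact_def)
  then show ?thesis using assms(1) by (auto simp: subact_def)
qed

lemma cyclic_act_image:
  assumes "cyclic_act S C act" "inj_on h C"
  shows "cyclic_act S (h ` C) (\<lambda>y s. h (act (inv_into C h y) s))"
proof -
  obtain c where c: "c \<in> C" "C = act c ` carrier S"
    using assms(1) by (auto simp: cyclic_act_def)
  have "h ` C = (\<lambda>s. h (act (inv_into C h (h c)) s)) ` carrier S"
    using c assms(2) by (metis image_image inv_into_f_f)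
  then show ?thesis
    using right_act_image[of S C act h] assms c(1) unfolding cyclic_act_def by blast
qed

text \<open>An extension problem moves to the copy under \<open>h\<close> by precomposing with the
  inverse of \<open>h\<close>; a solution there comes back by composing with
  \<open>h\<close>.\<close>

lemma injective_rel_inclusion_image:
  assumes "right_act S B act" "subact S A B act" "inj_on h B"
    and "injective_rel_inclusion S Q actQ (h ` A) (h ` B) (\<lambda>y s. h (act (inv_into B h y) s))"
  shows "injective_rel_inclusion S Q actQ A B act"
  unfolding injective_rel_inclusion_def
proof
  fix f assume f: "f \<in> act_hom S A act Q actQ"
  have AB: "A \<subseteq> B" and Acl: "\<And>a s. \<lbrakk>a \<in> A; s \<in> carrier S\<rbrakk> \<Longrightarrow> act a s \<in> A"
    using assms(2) by (auto simp: subact_def)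
  have inv: "inv_into B h (h b) = b" if "b \<in> B" for b
    using assms(3) that by auto
  have invA: "inv_into B h (h b) = b" if "b \<in> A" for b
    using AB that inv by auto
  have "f \<circ> inv_into B h \<in> act_hom S (h ` A) (\<lambda>y s. h (act (inv_into B h y) s)) Q actQ"
    using f Acl invA by (auto simp: act_hom_def)
  then obtain g where g: "g \<in> act_hom S (h ` B) (\<lambda>y s. h (act (inv_into B h y) s)) Q actQ"
    and gf: "\<forall>a\<in>h ` A. g a = (f \<circ> inv_into B h) a"
    using assms(4) unfolding injective_rel_inclusion_def by blast
  have "g \<circ> h \<in> act_hom S B act Q actQ"
    using g inv by (auto simp: act_hom_def)
  moreover have "\<forall>a\<in>A. (g \<circ> h) a = f a"
    using gf invA by auto
  ultimately show "\<exists>g\<in>act_hom S B act Q actQ. \<forall>a\<in>A. g a = f a" by blast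
qed

section \<open>Cyclic acts and change of the test type\<close>

text \<open>Every element of \<open>C = cS\<close> has the form \<open>cs\<close>, so choosing one
  such \<open>s\<close> for each element injects \<open>C\<close> into the monoid.\<close>

lemma cyclic_act_embedding:
  fixes S :: "('s, 'm) monoid_scheme" and C :: "'a set"
  assumes "cyclic_act S C act"
  obtains h :: "'a \<Rightarrow> 's + 'b" where "inj_on h C"
proof -
  obtain c where "C = act c ` carrier S"
    using assms by (auto simp: cyclic_act_def)
  then have "inj_on (Inl \<circ> inv_into (carrier S) (act c) :: 'a \<Rightarrow> 's + 'b) C"
    by (intro comp_inj_on inj_on_inv_into) auto
  then show ?thesis by (rule that)
qed

text \<open>Frees the hypothesis from its test type: a cyclic act over any type has a copy over
  \<open>'s + 'b\<close>, where the hypothesis applies.\<close>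

lemma cyclic_injective_actD:
  fixes S :: "('s, 'm) monoid_scheme"
  assumes "cyclic_injective_act TYPE('s + 'b) S Q actQ" "cyclic_act S C act" "subact S A C act"
  shows "injective_rel_inclusion S Q actQ A C act"
proof -
  obtain h :: "_ \<Rightarrow> 's + 'b" where h: "inj_on h C"
    using cyclic_act_embedding[OF assms(2)] .
  show ?thesis
    using assms cyclic_act_image[OF assms(2) h] subact_image[OF assms(3) h] h
    by (intro injective_rel_inclusion_image[of S C act A h])
       (auto simp: cyclic_injective_act_def cyclic_act_def)
qed

text \<open>Over one and the same test type this is a specialization; the passage to an unrelated
  type \<open>'c\<close> is the change of type for cyclic acts.\<close>

lemma injective_act_imp_cyclic_injective_act:
  fixes S :: "('s, 'm) monoid_scheme"
  assumes "injective_act TYPE('s + 'b) S Q actQ"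
  shows "cyclic_injective_act TYPE('c) S Q actQ"
proof -
  have "cyclic_injective_act TYPE('s + 'b) S Q actQ"
    using assms by (auto simp: injective_act_def cyclic_injective_act_def cyclic_act_def)
  note D = cyclic_injective_actD[OF this]
  show ?thesis
    unfolding cyclic_injective_act_def by (intro allI impI D)
qed

lemma cyclic_subact:
  assumes "right_act S B act" "b \<in> B"
  shows "cyclic_act S (act b ` carrier S) act"
proof -
  interpret right_act S B act by fact
  have mem: "b \<in> act b ` carrier S" using act_one[OF assms(2)] by (metis imageI one_closed)
  have "act a s \<in> act b ` carrier S" if "a \<in> act b ` carrier S" "s \<in> carrier S" for a s
  proof -
    obtain t where t: "t \<in> carrier S" "a = act b t" using \<open>a \<in> _\<close> by blast
    then have "act a s = act b (t \<otimes>\<^bsub>S\<^esub> s)" using act_mult[OF assms(2) t(1)] that(2) by simp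
    then show ?thesis using t(1) that(2) by simp
  qed
  moreover have "a \<in> B" if "a \<in> act b ` carrier S" for a
    using that act_closed[OF assms(2)] by blast
  ultimately have "right_act S (act b ` carrier S) act"
    using mem by unfold_locales (blast intro: act_mult act_one)+
  then show ?thesis using mem unfolding cyclic_act_def by blast
qed

section \<open>A zero from two disjoint right ideals\<close>

lemma cyclic_injective_act_zero:
  fixes S :: "('s, 'm) monoid_scheme"
  assumes "\<not> left_reversible S" "right_act S Q actQ"
    and inj: "cyclic_injective_act TYPE('s + 'b) S Q actQ"
  obtains z where "z \<in> Q" "\<And>s. s \<in> carrier S \<Longrightarrow> actQ z s = z"
proof -
  interpret Q: right_act S Q actQ by fact
  obtain I J where I: "right_ideal S I" and J: "right_ideal S J" and IJ: "I \<inter> J = {}"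
    using assms(1) by (auto simp: left_reversible_def)
  have Icl: "x \<otimes>\<^bsub>S\<^esub> s \<in> I" if "x \<in> I" "s \<in> carrier S" for x s
    using I that by (auto simp: right_ideal_def)
  have Jcl: "x \<otimes>\<^bsub>S\<^esub> s \<in> J" if "x \<in> J" "s \<in> carrier S" for x s
    using J that by (auto simp: right_ideal_def)
  have IS: "I \<subseteq> carrier S" and JS: "J \<subseteq> carrier S" and Jne: "J \<noteq> {}"
    using I J by (auto simp: right_ideal_def)
  obtain i where i: "i \<in> I" using I by (auto simp: right_ideal_def)
  have one: "\<one>\<^bsub>S\<^esub> \<notin> I"
  proof
    assume "\<one>\<^bsub>S\<^esub> \<in> I"
    then have "J \<subseteq> I" using Icl JS by (metis Q.l_one subset_iff)
    then show False using IJ Jne by blast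
  qed
  \<comment> \<open>The Rees quotient \<open>S/I\<close>, with \<open>i\<close> representing the collapsed class.\<close>
  define p where "p x = (if x \<in> I then i else x)" for x
  define act where "act x s = p (x \<otimes>\<^bsub>S\<^esub> s)" for x s
  define C where "C = p ` carrier S"
  have pS: "p x \<in> carrier S" if "x \<in> carrier S" for x
    using that i IS by (auto simp: p_def)
  \<comment> \<open>Since \<open>I\<close> is closed under right multiplication, the action does not
    depend on the representative. Thus \<open>p\<close> commutes with the action, and
    \<open>C\<close> inherits the act laws and the generator from the monoid.\<close>
  have p_act: "act (p x) s = p (x \<otimes>\<^bsub>S\<^esub> s)" if "x \<in> carrier S" "s \<in> carrier S" for x s
    using that i Icl by (auto simp: p_def act_def)
  have "right_act S C act"
    by unfold_locales (auto simp: C_def p_act Q.m_assoc intro!: imageI)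
  moreover have "p \<one>\<^bsub>S\<^esub> \<in> C" "C = act (p \<one>\<^bsub>S\<^esub>) ` carrier S"
    by (auto simp: C_def p_act)
  ultimately have cyc: "cyclic_act S C act"
    unfolding cyclic_act_def by blast
  \<comment> \<open>Disjointness from \<open>I\<close> lets \<open>J\<close> survive the collapse
    unchanged.\<close>
  have pJ: "p x = x" if "x \<in> J" for x using IJ that by (auto simp: p_def)
  have JC: "J \<subseteq> C" using JS pJ unfolding C_def by (metis image_eqI subsetD subsetI)
  have sub: "subact S J C act"
    using Jne JC Jcl pJ by (auto simp: subact_def act_def)
  obtain q where q: "q \<in> Q" using Q.nonempty by blast
  have "actQ q \<in> act_hom S J act Q actQ"
    using q JS Jcl pJ Q.act_closed Q.act_mult by (auto simp: act_hom_def act_def subset_iff)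
  then obtain g where g: "g \<in> act_hom S C act Q actQ"
    using cyclic_injective_actD[OF inj cyc sub] unfolding injective_rel_inclusion_def by blast
  have iC: "i \<in> C" using i IS by (auto simp: C_def p_def intro!: image_eqI[of _ _ i])
  \<comment> \<open>The product of \<open>i\<close> and \<open>s\<close> stays in \<open>I\<close>,
    which \<open>p\<close> collapses to \<open>i\<close>; a homomorphism preserves being
    fixed.\<close>
  have "act i s = i" if "s \<in> carrier S" for s
    using i Icl that by (auto simp: act_def p_def)
  then have "actQ (g i) s = g i" if "s \<in> carrier S" for s
    using g iC that by (force simp: act_hom_def)
  moreover have "g i \<in> Q" using g iC by (auto simp: act_hom_def)
  ultimately show ?thesis by (rule that[rotated])
qed

section \<open>The Baer-type extension argument\<close>

text \<open>The extension property is assumed only for the cyclic subacts of \<open>B\<close>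
  itself, so no second test type enters.\<close>

lemma injective_rel_inclusion_Baer:
  assumes B: "right_act S B act" and Q: "right_act S Q actQ" and A: "subact S A B act"
    and z: "z \<in> Q" "\<And>s. s \<in> carrier S \<Longrightarrow> actQ z s = z"
    and cyc: "\<And>b D. \<lbrakk>b \<in> B; subact S D (act b ` carrier S) act\<rbrakk> \<Longrightarrow>
      injective_rel_inclusion S Q actQ D (act b ` carrier S) act"
  shows "injective_rel_inclusion S Q actQ A B act"
  unfolding injective_rel_inclusion_def
proof
  interpret B: right_act S B act by fact
  fix f assume f: "f \<in> act_hom S A act Q actQ"
  \<comment> \<open>Partial extensions of \<open>f\<close> are encoded by their graphs: extending is
    then inclusion, and the union of a chain is its upper bound.\<close>
  define G where "G = (\<lambda>x. (x, f x)) ` A"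
  define \<F> where "\<F> = {F. F \<subseteq> B \<times> Q \<and> single_valued F \<and> G \<subseteq> F \<and>
    (\<forall>x y s. (x, y) \<in> F \<longrightarrow> s \<in> carrier S \<longrightarrow> (act x s, actQ y s) \<in> F)}"
  have G: "G \<in> \<F>"
    using f A by (auto simp: \<F>_def G_def act_hom_def subact_def single_valued_def)
  have "\<exists>M\<in>\<F>. \<forall>X\<in>\<F>. M \<subseteq> X \<longrightarrow> X = M"
  proof (rule subset_Zorn_nonempty)
    show "\<F> \<noteq> {}" using G by blast
    fix \<C> assume ne: "\<C> \<noteq> {}" and ch: "subset.chain \<F> \<C>"
    have sub: "\<C> \<subseteq> \<F>" and lin: "\<And>X Y. \<lbrakk>X \<in> \<C>; Y \<in> \<C>\<rbrakk> \<Longrightarrow> X \<subseteq> Y \<or> Y \<subseteq> X"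
      using ch by (auto simp: subset_chain_def)
    have "single_valued (\<Union>\<C>)"
    proof (rule single_valuedI)
      fix x y y' assume "(x, y) \<in> \<Union>\<C>" "(x, y') \<in> \<Union>\<C>"
      \<comment> \<open>Of the two members containing the pairs, the larger contains both.\<close>
      then obtain X where "X \<in> \<C>" "(x, y) \<in> X" "(x, y') \<in> X" using lin by blast
      then show "y = y'" using sub by (auto simp: \<F>_def dest: single_valuedD)
    qed
    moreover have "\<Union>\<C> \<subseteq> B \<times> Q" "G \<subseteq> \<Union>\<C>"
      using sub ne unfolding \<F>_def by blast+
    moreover have "(act x s, actQ y s) \<in> \<Union>\<C>" if "(x, y) \<in> \<Union>\<C>" "s \<in> carrier S" for x y s
      using sub that unfolding \<F>_def by blast
    ultimately show "\<Union>\<C> \<in> \<F>" by (simp add: \<F>_def)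
  qed
  then obtain M where M: "M \<in> \<F>" and max: "\<And>X. \<lbrakk>X \<in> \<F>; M \<subseteq> X\<rbrakk> \<Longrightarrow> X = M" by blast
  have MBQ: "M \<subseteq> B \<times> Q" and sv: "single_valued M" and GM: "G \<subseteq> M"
    and Mcl: "\<And>x y s. \<lbrakk>(x, y) \<in> M; s \<in> carrier S\<rbrakk> \<Longrightarrow> (act x s, actQ y s) \<in> M"
    using M by (auto simp: \<F>_def)
  \<comment> \<open>The function with graph \<open>M\<close>; its values matter only on
    \<open>Domain M\<close>.\<close>
  define m where "m x = (THE y. (x, y) \<in> M)" for x
  have m: "m x = y" if "(x, y) \<in> M" for x y
    using sv that unfolding m_def by (blast dest: single_valuedD)
  \<comment> \<open>Adjoining to \<open>M\<close> the graph of a homomorphism on \<open>bS\<close>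
    that agrees with \<open>m\<close> on the overlap gives a member of \<open>\<F>\<close>; by
    maximality it equals \<open>M\<close>, so \<open>b\<close> was already in the domain.\<close>
  have "b \<in> Domain M" if b: "b \<in> B" for b
  proof -
    define C where "C = act b ` carrier S"
    interpret C: right_act S C act
      using cyclic_subact[OF B b] by (simp add: C_def cyclic_act_def)
    have bC: "b \<in> C" unfolding C_def using B.act_one[OF b] by (metis imageI B.one_closed)
    have CB: "C \<subseteq> B" using B.act_closed[OF b] by (auto simp: C_def)
    obtain g where g: "g \<in> act_hom S C act Q actQ" and gm: "\<And>x. x \<in> Domain M \<inter> C \<Longrightarrow> g x = m x"
    proof (cases "Domain M \<inter> C = {}")
      case True
      \<comment> \<open>With empty overlap there is no subact to extend from; the constant map is a
        homomorphism because \<open>z\<close> is fixed.\<close>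
      have "(\<lambda>_. z) \<in> act_hom S C act Q actQ" using z by (auto simp: act_hom_def)
      then show ?thesis using that True by blast
    next
      case False
      then have "subact S (Domain M \<inter> C) C act"
        using Mcl C.act_closed unfolding subact_def by blast
      moreover have "m \<in> act_hom S (Domain M \<inter> C) act Q actQ"
        using m Mcl MBQ by (fastforce simp: act_hom_def)
      ultimately show ?thesis
        using that cyc[OF b] unfolding injective_rel_inclusion_def C_def by blast
    qed
    define N where "N = M \<union> (\<lambda>x. (x, g x)) ` C"
    \<comment> \<open>On the overlap both sources give the same value by \<open>gm\<close>, so
      \<open>y\<close> is determined by \<open>x\<close>.\<close>
    have "y = (if x \<in> C then g x else m x)" if "(x, y) \<in> N" for x y
      using that m[of x y] gm[of x] DomainI[of x y M] by (auto simp: N_def)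
    then have "single_valued N" by (metis single_valuedI)
    moreover have "N \<subseteq> B \<times> Q"
      using MBQ g CB by (auto simp: N_def act_hom_def)
    moreover have "G \<subseteq> N" using GM by (auto simp: N_def)
    moreover have "(act x s, actQ y s) \<in> N" if "(x, y) \<in> N" "s \<in> carrier S" for x y s
      using that(1) unfolding N_def
    proof
      assume "(x, y) \<in> M"
      then show "(act x s, actQ y s) \<in> M \<union> (\<lambda>x. (x, g x)) ` C" using Mcl that(2) by blast
    next
      assume "(x, y) \<in> (\<lambda>x. (x, g x)) ` C"
      then have "x \<in> C" "y = g x" by auto
      then have "actQ y s = g (act x s)" "act x s \<in> C"
        using g that(2) C.act_closed by (auto simp: act_hom_def)
      then show "(act x s, actQ y s) \<in> M \<union> (\<lambda>x. (x, g x)) ` C" by simp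
    qed
    ultimately have "N \<in> \<F>" by (simp add: \<F>_def)
    then have "N = M" using max by (simp add: N_def)
    then show ?thesis using bC by (auto simp: N_def)
  qed
  then have Mm: "(b, m b) \<in> M" if "b \<in> B" for b using m that by blast
  have "m (act b s) = actQ (m b) s" if "b \<in> B" "s \<in> carrier S" for b s
    using that by (intro m Mcl Mm)
  moreover have "m b \<in> Q" if "b \<in> B" for b using Mm[OF that] MBQ by blast
  ultimately have "m \<in> act_hom S B act Q actQ" by (simp add: act_hom_def)
  moreover have "\<forall>a\<in>A. m a = f a" using GM m by (auto simp: G_def)
  ultimately show "\<exists>g\<in>act_hom S B act Q actQ. \<forall>a\<in>A. g a = f a" by blast
qed

theorem proposition2p2:
  fixes S :: "('s, 'm) monoid_scheme"
    and Q :: "'q set" and actQ :: "'q \<Rightarrow> 's \<Rightarrow> 'q"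
  assumes "monoid S"
    and "\<not> left_reversible S"
    and "right_act S Q actQ"
  shows "injective_act TYPE('s + 'b) S Q actQ \<longleftrightarrow> cyclic_injective_act TYPE('s + 'c) S Q actQ"
proof
  assume "injective_act TYPE('s + 'b) S Q actQ"
  then show "cyclic_injective_act TYPE('s + 'c) S Q actQ"
    by (rule injective_act_imp_cyclic_injective_act)
next
  assume inj: "cyclic_injective_act TYPE('s + 'c) S Q actQ"
  obtain z where z: "z \<in> Q" "\<And>s. s \<in> carrier S \<Longrightarrow> actQ z s = z"
    using cyclic_injective_act_zero[OF assms(2,3) inj] by blast
  show "injective_act TYPE('s + 'b) S Q actQ"
    unfolding injective_act_def
  proof (intro allI impI)
    fix B :: "('s + 'b) set" and actB A
    assume B: "right_act S B actB" and A: "subact S A B actB"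
    show "injective_rel_inclusion S Q actQ A B actB"
      \<comment> \<open>The cyclic subacts of \<open>B\<close> live over \<open>'s + 'b\<close> and
        the hypothesis over \<open>'s + 'c\<close>; \<open>cyclic_injective_actD\<close> bridges the
        two.\<close>
      by (rule injective_rel_inclusion_Baer[OF B assms(3) A z])
         (auto intro: cyclic_injective_actD[OF inj cyclic_subact[OF B]])
  qed
qed

end
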